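(* Let $S$ be a measurable space, $P$ a probability measure on $S$, $n\geq 1$, and let $Z_1,\dots,Z_n$ be independent and identically distributed random variables with distribution $P$ on $S$. Let $\mathcal{A}$ be a countable class of measurable subsets of $S$. Then, for all $t>0$, $$ \mathbb P \left( \sup_{A\in \mathcal A} \frac{P_n(A) -P (A) }{\sqrt{ P_n(A) }} > t \right) \leq \mathbb S_{\mathcal A}(2n)\exp\left(-\frac{nt^2}{4}\right)$$ and $$ \mathbb P \left( \sup_{A\in \mathcal A } \frac{P(A) -P_n (A) }{\sqrt{ P (A ) }} > t \right)\leq 3\,\mathbb S_{\mathcal A}(2n) \exp\left(-\frac{nt^2}{4}\right).$$
   Context: For $A\in\mathcal A$, $P_n(A)=n^{-1}\sum_{i=1}^n \mathbf 1_A(Z_i)$ is the empirical measure of $A$. The shatter coefficient of a class $\mathcal A$ of subsets of $S$ is, for any $m\geq 1$, $$\mathbb S_{\mathcal A}(m) = \max_{(z_1,\ldots, z_m)\in S^m}\left|\{ (\mathbf 1_A(z_1),\ldots ,\mathbf 1_A(z_m)) \,:\, A\in \mathcal A\}\right|.$$ Convention: $0/0=0$, and a negative number divided by $0$ is $-\infty$. *)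

theory Defs
  imports "HOL-Probability.Probability"
begin

definition empirical_measure :: "nat \<Rightarrow> (nat \<Rightarrow> 'w \<Rightarrow> 'a) \<Rightarrow> 'w \<Rightarrow> 'a set \<Rightarrow> real" where
  "empirical_measure n Z \<omega> A = (1 / real n) * (\<Sum>i = 1..n. indicator A (Z i \<omega>))"

text \<open>
  Points of \<open>S\<^sup>m\<close> and 0-1 vectors of length \<open>m\<close> are extensional functions on \<open>{1..m}\<close>.
  For nonempty \<open>S\<close> the set whose maximum is taken is a nonempty subset of \<open>{0..2 ^ m}\<close>,
  also when \<open>\<A>\<close> is infinite.
\<close>

definition shatter_coeff :: "'a set \<Rightarrow> 'a set set \<Rightarrow> nat \<Rightarrow> nat" where
  "shatter_coeff S \<A> m =
     Max ((\<lambda>z. card ((\<lambda>A. \<lambda>i\<in>{1..m}. indicator A (z i) :: nat) ` \<A>)) ` ({1..m} \<rightarrow>\<^sub>E S))"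

text \<open>
  The ratios below are quotients in \<^typ>\<open>ereal\<close>, where \<open>0 / 0 = 0\<close> and a negative number divided
  by \<open>0\<close> is \<open>-\<infinity>\<close> (over \<^typ>\<open>real\<close> the latter would be \<open>0\<close>). The supremum over the
  empty class is \<open>-\<infinity>\<close>.
\<close>

lemma ereal_zero_div_zero: "ereal 0 / ereal 0 = 0"
  by simp

lemma ereal_neg_div_zero: "x < 0 \<Longrightarrow> ereal x / ereal 0 = -\<infinity>"
  by (simp add: divide_ereal_def)

definition sup_dev_empirical ::
  "'a measure \<Rightarrow> nat \<Rightarrow> (nat \<Rightarrow> 'w \<Rightarrow> 'a) \<Rightarrow> 'a set set \<Rightarrow> 'w \<Rightarrow> ereal" where
  "sup_dev_empirical P n Z \<A> \<omega> =
     (SUP A\<in>\<A>. ereal (empirical_measure n Z \<omega> A - measure P A)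
                / ereal (sqrt (empirical_measure n Z \<omega> A)))"

definition sup_dev_true ::
  "'a measure \<Rightarrow> nat \<Rightarrow> (nat \<Rightarrow> 'w \<Rightarrow> 'a) \<Rightarrow> 'a set set \<Rightarrow> 'w \<Rightarrow> ereal" where
  "sup_dev_true P n Z \<A> \<omega> =
     (SUP A\<in>\<A>. ereal (measure P A - empirical_measure n Z \<omega> A)
                / ereal (sqrt (measure P A)))"

end

theory Submission
  imports Defs
begin

text \<open>
  Both inequalities come from one symmetrization argument in which the ghost sample is integrated
  out by Jensen's inequality for an exponential weight.  The usual step, which bounds from below
  the probability that the ghost sample behaves typically, would lose a constant factor.

  Let \<open>a\<close> and \<open>b\<close> be the numbers of hits of \<open>A\<close> in the sample and in an independent ghost sample,
  both of size \<open>n\<close>, and let the weight be \<open>exp (c (a - b) / sqrt (a + b) - c\<^sup>2 / 2)\<close>.  Exchanging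
  corresponding points of the two samples at random does not change \<open>a + b\<close> and multiplies the
  contributions to \<open>a - b\<close> by random signs.  By \<open>cosh x \<le> exp (x\<^sup>2 / 2)\<close> the weight averages to at
  most \<open>1\<close> over these swaps (\<open>sum_swap_weight_le\<close>).  Only the trace of \<open>A\<close> on the \<open>2 n\<close> points matters,
  so the expected supremum of the weight over the class is at most the shatter coefficient at
  \<open>2 n\<close> (\<open>expectation_sup_swap_weight_le\<close>).

  Now fix the sample and let \<open>A\<close> have a large relative deviation.  If the weight, as a function of
  \<open>b\<close>, has a supporting line at the mean \<open>x = n P(A)\<close>, then its conditional expectation is at
  least its value at \<open>b = x\<close>.  The deviation means \<open>\<bar>a - x\<bar> > t sqrt n sqrt (max a x)\<close>, hence
  \<open>\<bar>a - x\<bar> / sqrt (a + x) > t sqrt (n / 2)\<close>, and with \<open>\<bar>c\<bar> = t sqrt (n / 2)\<close> the value is at least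
  \<open>exp (c\<^sup>2 / 2) = exp (n t\<^sup>2 / 4)\<close>.  Markov's inequality gives the shatter coefficient times
  \<open>exp (- n t\<^sup>2 / 4)\<close> (\<open>measure_le_of_supporting_line\<close>).

  It remains to find the supporting lines.  For \<open>a > x\<close> the constant \<open>c\<close> is positive and the weight
  is convex in \<open>b\<close> (\<open>supporting_line_excess\<close>).  For \<open>a < x\<close> the constant is negative and the exponent
  is concave; the line exists if \<open>\<bar>c\<bar> sqrt (a + x) \<ge> 3\<close> (\<open>supporting_line_deficit\<close>).  The deviation
  itself forces \<open>x > n t\<^sup>2\<close>, so this holds once \<open>n t\<^sup>2 > 17 / 4\<close>.  For smaller \<open>n t\<^sup>2\<close> the second
  inequality is trivial, since \<open>3 exp (- 17 / 16) \<ge> 1\<close>.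
\<close>

section \<open>Supporting lines for exponentials of the scaled difference\<close>

text \<open>
  The series of \<open>ln (1 - e)\<close> cut after two terms.  The quadratic term is what beats the concavity
  of the exponent in the next lemma.
\<close>
lemma one_minus_le_exp_quadratic: "1 - e \<le> exp (- e - e\<^sup>2 / 2)" if "0 \<le> e" "e < 1" for e :: real
proof -
  have "(\<lambda>x. - x - x\<^sup>2 / 2 - ln (1 - x)) 0 \<le> (\<lambda>x. - x - x\<^sup>2 / 2 - ln (1 - x)) e"
  proof (rule DERIV_nonneg_imp_nondecreasing[OF that(1)])
    fix x :: real assume x: "0 \<le> x" "x \<le> e"
    then have "x < 1" using that by simp
    have "((\<lambda>x. - x - x\<^sup>2 / 2 - ln (1 - x)) has_real_derivative (- 1 - x + 1 / (1 - x))) (at x)"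
      using \<open>x < 1\<close> by (auto intro!: derivative_eq_intros simp: field_simps)
    moreover have "- 1 - x + 1 / (1 - x) = x\<^sup>2 / (1 - x)"
      using \<open>x < 1\<close> by (simp add: field_simps power2_eq_square)
    ultimately show "\<exists>y. ((\<lambda>x. - x - x\<^sup>2 / 2 - ln (1 - x)) has_real_derivative y) (at x) \<and> 0 \<le> y"
      using \<open>x < 1\<close> by (metis diff_ge_0_iff_ge less_eq_real_def zero_le_divide_iff zero_le_power2)
  qed
  then have "ln (1 - e) \<le> - e - e\<^sup>2 / 2" by simp
  then show ?thesis using that by (metis diff_gt_0_iff_gt exp_le_cancel_iff exp_ln)
qed

text \<open>
  The exponent \<open>m (r - q / r - (1 - q))\<close> is concave in \<open>r\<^sup>2\<close>, and the left-hand side is the tangent,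
  again in \<open>r\<^sup>2\<close>, of its exponential at \<open>r = 1\<close>.  The tangent stays below because the exponential is steep enough:
  for \<open>r \<ge> 1\<close> the second-order Taylor term of the exponential suffices; for \<open>r < 1\<close> the tangent
  falls so quickly that it is already nonpositive unless \<open>r > 0.57\<close>, and there the previous lemma
  applies.
\<close>
lemma tangent_below_exp_concave:
  fixes m q r :: real
  assumes m: "m \<ge> 3" and q: "0 \<le> q" "q \<le> 2" and r: "0 \<le> r"
  shows "1 + m / 2 * (r\<^sup>2 - 1) * (1 + q) \<le> exp (m * (r - q / r - (1 - q)))"
proof (cases "r \<ge> 1")
  case True
  define d where "d = r - 1"
  define p where "p = q / r"
  have d: "d \<ge> 0" using True by (simp add: d_def)
  have p: "0 \<le> p" "p \<le> q" "q = p + p * d"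
    using True q by (auto simp: p_def d_def field_simps mult_le_cancel_left1)
  have "1 + q + 2 * p \<le> 3 * (1 + p)\<^sup>2"
  proof -
    have "3 * (1 + p)\<^sup>2 = 3 + 6 * p + 3 * p\<^sup>2" by (simp add: power2_eq_square algebra_simps)
    then show ?thesis using p(1) q(2) zero_le_power2[of p] by linarith
  qed
  also have "\<dots> \<le> m * (1 + p)\<^sup>2" using m by (intro mult_right_mono) auto
  finally have quad: "m * d\<^sup>2 / 2 * (1 + q + 2 * p) \<le> m * d\<^sup>2 / 2 * (m * (1 + p)\<^sup>2)"
    by (intro mult_left_mono) (use m in auto)
  have z: "m * (r - q / r - (1 - q)) = m * d * (1 + p)"
    using True by (simp add: p_def d_def field_simps)
  have r: "r = 1 + d" by (simp add: d_def)
  have "1 + m / 2 * (r\<^sup>2 - 1) * (1 + q) = 1 + m * d * (1 + p) + m * d\<^sup>2 / 2 * (1 + q + 2 * p)"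
    unfolding r p(3) by (simp add: field_simps power2_eq_square)
  also have "\<dots> \<le> 1 + m * d * (1 + p) + m * d\<^sup>2 / 2 * (m * (1 + p)\<^sup>2)"
    by (rule add_left_mono[OF quad])
  also have "m * d\<^sup>2 / 2 * (m * (1 + p)\<^sup>2) = (m * d * (1 + p))\<^sup>2 / 2"
    by (simp add: power2_eq_square)
  also have "1 + (m * d * (1 + p)) + (m * d * (1 + p))\<^sup>2 / 2 \<le> exp (m * d * (1 + p))"
    by (rule exp_lower_Taylor_quadratic) (use m d p in auto)
  finally show ?thesis unfolding z .
next
  case False
  define e where "e = m / 2 * (1 - r\<^sup>2) * (1 + q)"
  have L: "1 + m / 2 * (r\<^sup>2 - 1) * (1 + q) = 1 - e" by (simp add: e_def field_simps)
  have r1: "r\<^sup>2 \<le> 1" using False r by (simp add: power_le_one)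
  show ?thesis
  proof (cases "e < 1")
    case e: True
    \<comment> \<open>A positive tangent value, i.e. \<open>e < 1\<close>, keeps \<open>r\<^sup>2\<close> above \<open>1 / 3 > 0.57\<^sup>2\<close>.\<close>
    have "3 / 2 * (1 - r\<^sup>2) \<le> m / 2 * (1 - r\<^sup>2)" using m r1 by (intro mult_right_mono) auto
    also have "\<dots> = m / 2 * (1 - r\<^sup>2) * 1" by simp
    also have "\<dots> \<le> e" unfolding e_def using q m r1 by (intro mult_left_mono) auto
    finally have "(57 / 100)\<^sup>2 < r\<^sup>2" using e by (simp add: power2_eq_square)
    then have r57: "57 / 100 < r" using r power2_less_imp_less by blast
    have "q / r \<le> q / (57 / 100)" using r57 q by (intro divide_left_mono) auto
    then have qr: "q / r \<le> 1.755 * q" using q by simp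
    \<comment> \<open>With \<open>1 / r < 1.755\<close> a quadratic inequality in \<open>q\<close> without real roots is left.\<close>
    have "(q - 1 / 4)\<^sup>2 = q\<^sup>2 - q / 2 + 1 / 16"
      by (simp add: power2_eq_square field_simps)
    then have "q\<^sup>2 - q / 2 + 1 / 16 \<ge> 0" using zero_le_power2[of "q - 1 / 4"] by simp
    then have "1 + q + 2 * (q / r) \<le> 9 / 5 * (1 + 2 * q + q\<^sup>2)"
      using qr q by simp
    also have "1 + 2 * q + q\<^sup>2 = (1 + q)\<^sup>2"
      by (simp add: power2_eq_square algebra_simps)
    also have "(157 / 100)\<^sup>2 \<le> (1 + r)\<^sup>2" using r57 by (intro power_mono) auto
    then have "3 / 4 * (157 / 100)\<^sup>2 \<le> m / 4 * (1 + r)\<^sup>2"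
      using m by (intro mult_mono) auto
    then have "9 / 5 * (1 + q)\<^sup>2 \<le> m / 4 * (1 + r)\<^sup>2 * (1 + q)\<^sup>2"
      by (intro mult_right_mono) (auto simp: power2_eq_square)
    finally have "1 + q + 2 * (q / r) \<le> m / 4 * (1 + r)\<^sup>2 * (1 + q)\<^sup>2" .
    then have "m / 2 * (1 - r)\<^sup>2 * (1 + q + 2 * (q / r)) \<le> m / 2 * (1 - r)\<^sup>2 * (m / 4 * (1 + r)\<^sup>2 * (1 + q)\<^sup>2)"
      by (intro mult_left_mono) (use m in auto)
    also have "\<dots> = e\<^sup>2 / 2"
    proof -
      have e': "e = m / 2 * ((1 - r) * (1 + r)) * (1 + q)"
        by (simp add: e_def power2_eq_square algebra_simps)
      show ?thesis unfolding e' by (simp add: power2_eq_square)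
    qed
    finally have "e + m / 2 * (1 - r)\<^sup>2 * (1 + q + 2 * (q / r)) \<le> e + e\<^sup>2 / 2" by simp
    also have "e + m / 2 * (1 - r)\<^sup>2 * (1 + q + 2 * (q / r)) = - (m * (r - q / r - (1 - q)))"
    proof -
      define p where "p = q / r"
      have "q = p * r" using r57 by (simp add: p_def)
      then show ?thesis unfolding p_def[symmetric] e_def by (simp add: power2_eq_square field_simps)
    qed
    finally have "- e - e\<^sup>2 / 2 \<le> m * (r - q / r - (1 - q))" by linarith
    moreover have "0 \<le> e" unfolding e_def using m q r1 by auto
    ultimately show ?thesis
      unfolding L using one_minus_le_exp_quadratic[of e] e by (meson exp_le_cancel_iff order_trans)
  next
    case False
    then show ?thesis unfolding L by (smt (verit) exp_gt_zero)
  qed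
qed

text \<open>
  For numbers of hits \<open>a\<close> and \<open>b\<close> in two samples of equal size, \<open>a + b\<close> bounds the number of
  indices at which the samples disagree about a hit; dividing by its root makes
  \<open>a - b\<close> subgaussian under random swaps between the samples.  At \<open>a = b = 0\<close> the value is
  \<open>0 / 0 = 0\<close>.
\<close>
definition scaled_diff :: "real \<Rightarrow> real \<Rightarrow> real" where
  "scaled_diff a b = (a - b) / sqrt (a + b)"

text \<open>
  In the coordinate \<open>r\<close>, the root of the ratio of the denominators, both the scaled difference and
  the step from \<open>x\<close> to \<open>y\<close> become elementary, and the base point is \<open>r = 1\<close>.
\<close>
lemma scaled_diff_substitution:
  fixes a x y :: real
  assumes "0 \<le> a" "0 \<le> x" "0 \<le> y" "0 < a + x"
  defines "s \<equiv> sqrt (a + x)"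
  defines "q \<equiv> 2 * a / (a + x)" and "r \<equiv> sqrt (a + y) / s"
  shows "scaled_diff a y = s * (q / r - r)" "scaled_diff a x = s * (q - 1)"
    "y - x = s\<^sup>2 * (r\<^sup>2 - 1)" "0 \<le> q" "q \<le> 2" "0 \<le> r"
proof -
  have s: "s > 0" "s\<^sup>2 = a + x" using assms by (auto simp: s_def)
  show "scaled_diff a y = s * (q / r - r)"
  proof (cases "a + y = 0")
    case False
    then have "sqrt (a + y) > 0" "(sqrt (a + y))\<^sup>2 = a + y" using assms by auto
    then show ?thesis using s
      unfolding scaled_diff_def q_def r_def s(2)[symmetric] by (simp add: field_simps power2_eq_square)
  qed (use assms in \<open>auto simp: scaled_diff_def\<close>)
  have "s\<^sup>2 * q = 2 * a" using s assms(4) by (simp add: q_def)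
  then have "a - x = s * (s * (q - 1))" using s(2) by (simp add: power2_eq_square algebra_simps)
  then show "scaled_diff a x = s * (q - 1)"
    unfolding scaled_diff_def s_def[symmetric] using s(1) by simp
  show "y - x = s\<^sup>2 * (r\<^sup>2 - 1)"
    using s assms by (simp add: r_def power_divide field_simps)
qed (use assms in \<open>auto simp: divide_le_eq\<close>)

text \<open>
  As a function of \<open>u = a + y\<close>, the scaled difference is \<open>2 a / sqrt u - sqrt u\<close>, which is convex;
  so is its exponential, and the tangent at \<open>x\<close> is a supporting line.
\<close>
lemma supporting_line_excess:
  fixes a x c :: real
  assumes "0 < a" "0 \<le> x" "0 \<le> c"
  shows "\<exists>\<kappa>. \<forall>y\<ge>0. 1 + \<kappa> * (y - x) \<le> exp (c * (scaled_diff a y - scaled_diff a x))"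
proof -
  define s where "s = sqrt (a + x)"
  define q where "q = 2 * a / (a + x)"
  have s: "s > 0" using assms by (simp add: s_def)
  have "1 + (- c * (1 + q) / (2 * s)) * (y - x) \<le> exp (c * (scaled_diff a y - scaled_diff a x))" if y: "0 \<le> y" for y
  proof -
    define r where "r = sqrt (a + y) / s"
    have "0 < a + x" using assms by simp
    note sc = scaled_diff_substitution[of a x y, folded s_def q_def, folded r_def, OF less_imp_le[OF assms(1)] assms(2) y this]
    have r: "r > 0" unfolding r_def using s assms y by simp
    have "(q / r - r) - (q - 1) + (r\<^sup>2 - 1) * (1 + q) / 2 = (1 - r)\<^sup>2 / 2 * (1 + q * (2 + r) / r)"
      using r by (simp add: field_simps power2_eq_square)
    also have "\<dots> \<ge> 0" using r sc assms y by auto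
    finally have "c * s * ((q / r - r) - (q - 1) + (r\<^sup>2 - 1) * (1 + q) / 2) \<ge> 0"
      using s assms by auto
    moreover have "(- c * (1 + q) / (2 * s)) * (y - x) = - (c * s) * ((r\<^sup>2 - 1) * (1 + q) / 2)"
      using s unfolding sc(3) by (simp add: power2_eq_square)
    moreover have "c * (scaled_diff a y - scaled_diff a x) = (c * s) * ((q / r - r) - (q - 1))"
      unfolding sc(1,2) by (simp add: algebra_simps)
    ultimately have "(- c * (1 + q) / (2 * s)) * (y - x) \<le> c * (scaled_diff a y - scaled_diff a x)"
      unfolding distrib_left[of "c * s"] by argo
    then show ?thesis using exp_ge_add_one_self[of "c * (scaled_diff a y - scaled_diff a x)"] by linarith
  qed
  then show ?thesis by blast
qed

text \<open>
  With the opposite sign the exponent is concave, yet a supporting line at \<open>x\<close> exists as soon as the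
  multiplier is large compared with \<open>1 / sqrt (a + x)\<close>.
\<close>
lemma supporting_line_deficit:
  fixes a x c :: real
  assumes "0 \<le> a" "0 \<le> x" "3 \<le> c * sqrt (a + x)"
  shows "\<exists>\<kappa>. \<forall>y\<ge>0. 1 + \<kappa> * (y - x) \<le> exp (- c * (scaled_diff a y - scaled_diff a x))"
proof -
  define s where "s = sqrt (a + x)"
  define q where "q = 2 * a / (a + x)"
  have s: "s > 0" "a + x > 0" using assms unfolding s_def by (auto simp: less_le add_nonneg_eq_0_iff)
  have "1 + (c * (1 + q) / (2 * s)) * (y - x) \<le> exp (- c * (scaled_diff a y - scaled_diff a x))" if y: "0 \<le> y" for y
  proof -
    define r where "r = sqrt (a + y) / s"
    note sc = scaled_diff_substitution[of a x y, folded s_def q_def, folded r_def, OF assms(1,2) y s(2)]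
    have "1 + (c * s) / 2 * (r\<^sup>2 - 1) * (1 + q) \<le> exp ((c * s) * (r - q / r - (1 - q)))"
      by (rule tangent_below_exp_concave) (use sc assms s_def in auto)
    moreover have "(c * s) / 2 * (r\<^sup>2 - 1) * (1 + q) = (c * (1 + q) / (2 * s)) * (y - x)"
      using s unfolding sc(3) by (simp add: power2_eq_square)
    moreover have "(c * s) * (r - q / r - (1 - q)) = - c * (scaled_diff a y - scaled_diff a x)"
      unfolding sc(1,2) by (simp add: algebra_simps)
    ultimately show ?thesis by simp
  qed
  then show ?thesis by blast
qed

section \<open>Averaging over swaps between two samples\<close>

text \<open>Hoeffding's lemma for a uniformly distributed sign.\<close>
lemma cosh_le_exp_half_square: "exp x + exp (- x) \<le> 2 * exp (x\<^sup>2 / 2)" for x :: real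
proof (cases "x = 0")
  case False
  interpret prob_space "measure_pmf (pmf_of_set {-1, 1 :: real})"
    by (rule measure_pmf.prob_space_axioms)
  interpret interval_bounded_random_variable "measure_pmf (pmf_of_set {-1, 1 :: real})" "\<lambda>v. v" "-1" 1
    by unfold_locales (auto simp: AE_measure_pmf_iff)
  have "nn_integral (measure_pmf (pmf_of_set {-1, 1})) (\<lambda>v. exp (\<bar>x\<bar> * v))
      \<le> ennreal (exp (\<bar>x\<bar>\<^sup>2 * (1 - (-1))\<^sup>2 / 8))"
    by (rule Hoeffdings_lemma_nn_integral_0) (use False in \<open>auto simp: integral_pmf_of_set\<close>)
  also have "nn_integral (measure_pmf (pmf_of_set {-1, 1})) (\<lambda>v. exp (\<bar>x\<bar> * v))
      = ennreal ((exp \<bar>x\<bar> + exp (- \<bar>x\<bar>)) / 2)"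
    by (simp add: nn_integral_pmf_of_set divide_ennreal[symmetric] add.commute flip: ennreal_plus)
  finally have "exp \<bar>x\<bar> + exp (- \<bar>x\<bar>) \<le> 2 * exp (x\<^sup>2 / 2)"
    by (simp add: ennreal_le_iff)
  then show ?thesis by (auto simp: abs_if split: if_splits)
qed simp

definition swap_weight :: "real \<Rightarrow> real \<Rightarrow> real \<Rightarrow> real" where
  "swap_weight c a b = exp (c * scaled_diff a b - c\<^sup>2 / 2)"

text \<open>
  The sample occupies the indices \<open>1..n\<close> and the ghost sample \<open>n+1..2n\<close>; the permutation exchanges
  \<open>i\<close> and \<open>i + n\<close> for \<open>i \<in> J\<close>.  It is meant for \<open>J \<subseteq> {1..n}\<close>: then \<open>0 \<notin> J\<close>, so that truncated
  subtraction cannot put an \<open>i \<le> n\<close> into the second branch.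
\<close>
definition swap_index :: "nat \<Rightarrow> nat set \<Rightarrow> nat \<Rightarrow> nat" where
  "swap_index n J i = (if i \<in> J then i + n else if i - n \<in> J then i - n else i)"

lemma swap_index_permutes:
  assumes "J \<subseteq> {1..n}"
  shows "swap_index n J \<in> {1..2 * n} \<rightarrow> {1..2 * n}" "inj_on (swap_index n J) {1..2 * n}"
proof -
  show "swap_index n J \<in> {1..2 * n} \<rightarrow> {1..2 * n}"
    using assms by (auto simp: swap_index_def subset_iff)
  have "swap_index n J (swap_index n J i) = i" if "i \<in> {1..2 * n}" for i
    using assms that by (force simp: swap_index_def subset_iff)
  then show "inj_on (swap_index n J) {1..2 * n}" by (rule inj_on_inverseI)
qed

text \<open>
  A swap of \<open>i\<close> and \<open>i + n\<close> flips the sign of \<open>d i = f i - f (i + n)\<close> and leaves the sum \<open>a + b = u\<close>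
  unchanged.  Hence the exponent is a sum of independent random signs times \<open>c d i / sqrt u\<close>, the
  average over all swaps is a product of hyperbolic cosines, and \<open>\<Sum> (d i)\<^sup>2 \<le> u\<close> shows that
  the factor \<open>exp (- c\<^sup>2 / 2)\<close> compensates for it.
\<close>
lemma sum_swap_weight_le:
  fixes f :: "nat \<Rightarrow> nat"
  assumes f: "\<And>i. i \<in> {1..2 * n} \<Longrightarrow> f i \<le> 1"
  shows "(\<Sum>J\<in>Pow {1..n}. swap_weight c (\<Sum>i=1..n. real (f (swap_index n J i)))
           (\<Sum>i=n+1..2 * n. real (f (swap_index n J i)))) \<le> 2 ^ n"
proof -
  define u where "u = (\<Sum>i=1..n. real (f i) + real (f (i + n)))"
  define d where "d i = real (f i) - real (f (i + n))" for i
  define \<theta> where "\<theta> = c / sqrt u"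
  have u0: "u \<ge> 0" unfolding u_def by (intro sum_nonneg) auto
  have w: "swap_weight c (\<Sum>i=1..n. real (f (swap_index n J i))) (\<Sum>i=n+1..2 * n. real (f (swap_index n J i)))
      = exp (- c\<^sup>2 / 2) * ((\<Prod>i\<in>J. exp (- (\<theta> * d i))) * (\<Prod>i\<in>{1..n} - J. exp (\<theta> * d i)))"
    if J: "J \<in> Pow {1..n}" for J
  proof -
    have fJ: "finite J" using J finite_subset by auto
    define a where "a = (\<Sum>i=1..n. real (f (swap_index n J i)))"
    define b where "b = (\<Sum>i=n+1..2 * n. real (f (swap_index n J i)))"
    have b: "b = (\<Sum>i=1..n. real (f (swap_index n J (i + n))))"
      unfolding b_def mult_2 using sum.shift_bounds_cl_nat_ivl[of "\<lambda>i. real (f (swap_index n J i))" 1 n n]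
      by (simp add: add.commute)
    have ab: "a + b = u" unfolding a_def b u_def sum.distrib[symmetric]
      by (rule sum.cong) (use J in \<open>auto simp: swap_index_def subset_iff\<close>)
    have "a - b = (\<Sum>i=1..n. if i \<in> J then - d i else d i)"
      unfolding a_def b sum_subtractf[symmetric] d_def
      by (rule sum.cong) (use J in \<open>auto simp: swap_index_def subset_iff\<close>)
    also have "\<dots> = (\<Sum>i\<in>{1..n} \<inter> J. - d i) + (\<Sum>i\<in>{1..n} - J. d i)"
      by (subst sum.If_cases) (auto simp: Diff_eq)
    also have "{1..n} \<inter> J = J" using J by auto
    finally have "a - b = (\<Sum>i\<in>J. - d i) + (\<Sum>i\<in>{1..n} - J. d i)" .
    then have "\<theta> * (a - b) = \<theta> * (\<Sum>i\<in>J. - d i) + \<theta> * (\<Sum>i\<in>{1..n} - J. d i)"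
      by (simp only: distrib_left)
    then have "c * scaled_diff a b = (\<Sum>i\<in>J. - (\<theta> * d i)) + (\<Sum>i\<in>{1..n} - J. \<theta> * d i)"
      unfolding scaled_diff_def ab \<theta>_def
      by (simp add: sum_distrib_left)
    moreover have "exp (x + y - c\<^sup>2 / 2) = exp (- c\<^sup>2 / 2) * (exp x * exp y)" for x y :: real
      by (simp flip: exp_add)
    ultimately show ?thesis
      unfolding a_def[symmetric] b_def[symmetric] swap_weight_def
      using fJ by (simp only: exp_sum finite_Diff finite_atLeastAtMost)
  qed
  have "(\<Sum>J\<in>Pow {1..n}. swap_weight c (\<Sum>i=1..n. real (f (swap_index n J i)))
           (\<Sum>i=n+1..2 * n. real (f (swap_index n J i))))
      = exp (- c\<^sup>2 / 2) * (\<Prod>i=1..n. exp (- (\<theta> * d i)) + exp (\<theta> * d i))"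
    unfolding prod_add[OF finite_atLeastAtMost] sum_distrib_left by (rule sum.cong[OF refl w])
  also have "(\<Prod>i=1..n. exp (- (\<theta> * d i)) + exp (\<theta> * d i))
      \<le> (\<Prod>i=1..n. 2 * exp (\<theta>\<^sup>2 / 2 * (real (f i) + real (f (i + n)))))"
  proof (intro prod_mono conjI)
    fix i assume i: "i \<in> {1..n}"
    have "f i \<le> 1" "f (i + n) \<le> 1" using f[of i] f[of "i + n"] i by auto
    then have "(d i)\<^sup>2 \<le> real (f i) + real (f (i + n))"
      by (auto simp: d_def le_Suc_eq power2_eq_square)
    then have "(\<theta> * d i)\<^sup>2 / 2 \<le> \<theta>\<^sup>2 / 2 * (real (f i) + real (f (i + n)))"
      by (simp add: power_mult_distrib mult_left_mono)
    then show "exp (- (\<theta> * d i)) + exp (\<theta> * d i) \<le> 2 * exp (\<theta>\<^sup>2 / 2 * (real (f i) + real (f (i + n))))"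
      using cosh_le_exp_half_square[of "\<theta> * d i"] by (smt (verit) exp_le_cancel_iff)
  qed (auto intro: add_nonneg_nonneg)
  also have "\<dots> = 2 ^ n * exp (\<theta>\<^sup>2 / 2 * u)"
    unfolding prod.distrib u_def sum_distrib_left by (simp add: exp_sum)
  also have "exp (- c\<^sup>2 / 2) * (2 ^ n * exp (\<theta>\<^sup>2 / 2 * u)) = 2 ^ n * exp (\<theta>\<^sup>2 / 2 * u - c\<^sup>2 / 2)"
    by (simp flip: exp_add)
  also have "\<theta>\<^sup>2 * u \<le> c\<^sup>2" using u0 by (cases "u = 0") (auto simp: \<theta>_def power_divide)
  then have "2 ^ n * exp (\<theta>\<^sup>2 / 2 * u - c\<^sup>2 / 2) \<le> 2 ^ n * exp 0"
    by (intro mult_left_mono) auto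
  finally show ?thesis by simp
qed

section \<open>The double sample\<close>

text \<open>
  The maximum in the shatter coefficient is attained because all trace counts are bounded by the
  size of the cube \<open>{0, 1}\<^sup>m\<close>, however large the space and the class are.
\<close>
lemma card_traces_le_shatter_coeff:
  fixes \<A> :: "'a set set"
  assumes z: "z \<in> {1..m} \<rightarrow>\<^sub>E S"
  defines "T \<equiv> (\<lambda>A. \<lambda>i\<in>{1..m}. indicator A (z i) :: nat) ` \<A>"
  shows "finite T" "card T \<le> shatter_coeff S \<A> m"
proof -
  have fin: "finite ({1..m} \<rightarrow>\<^sub>E {0, 1 :: nat})" by (intro finite_PiE) auto
  have sub: "(\<lambda>A. \<lambda>i\<in>{1..m}. indicator A (z i) :: nat) ` \<A> \<subseteq> {1..m} \<rightarrow>\<^sub>E {0, 1}" for z :: "nat \<Rightarrow> 'a"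
    by (auto simp: indicator_def)
  show "finite T" unfolding T_def using finite_subset[OF sub fin] .
  have "card ((\<lambda>A. \<lambda>i\<in>{1..m}. indicator A (z i) :: nat) ` \<A>)
      \<in> {..card ({1..m} \<rightarrow>\<^sub>E {0, 1 :: nat})}" for z :: "nat \<Rightarrow> 'a"
    using card_mono[OF fin sub] by simp
  then have "finite ((\<lambda>z. card ((\<lambda>A. \<lambda>i\<in>{1..m}. indicator A (z i) :: nat) ` \<A>)) ` ({1..m} \<rightarrow>\<^sub>E S))"
    by (intro finite_subset[OF image_subsetI finite_atMost])
  then show "card T \<le> shatter_coeff S \<A> m"
    unfolding T_def shatter_coeff_def using z by (intro Max_ge) auto
qed

definition hit_count :: "nat set \<Rightarrow> (nat \<Rightarrow> 'a) \<Rightarrow> 'a set \<Rightarrow> real" where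
  "hit_count I z A = (\<Sum>i\<in>I. indicator A (z i))"

lemma measurable_hit_count:
  assumes "A \<in> sets P" "I \<subseteq> K"
  shows "(\<lambda>z. hit_count I z A) \<in> borel_measurable (PiM K (\<lambda>_. P))"
  unfolding hit_count_def
proof (rule borel_measurable_sum)
  fix i assume "i \<in> I"
  then have "i \<in> K" using assms by auto
  have "(indicator A :: _ \<Rightarrow> real) \<in> borel_measurable P" using assms by simp
  then show "(\<lambda>z. indicator A (z i) :: real) \<in> borel_measurable (PiM K (\<lambda>_. P))"
    by (rule measurable_compose[OF measurable_component_singleton[OF \<open>i \<in> K\<close>]])
qed

lemma measurable_swap_weight:
  assumes [measurable]: "f \<in> borel_measurable N" "g \<in> borel_measurable N"
  shows "(\<lambda>z. swap_weight c (f z) (g z)) \<in> borel_measurable N"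
  unfolding swap_weight_def scaled_diff_def by measurable

lemma measurable_sup_swap_weight:
  assumes "countable \<A>" "\<A> \<subseteq> sets P" "I \<subseteq> K" "J \<subseteq> K"
  shows "(\<lambda>z. SUP A\<in>\<A>. ennreal (swap_weight c (hit_count I z A) (hit_count J z A)))
    \<in> borel_measurable (PiM K (\<lambda>_. P))"
proof (rule borel_measurable_SUP[OF assms(1)])
  fix A assume "A \<in> \<A>"
  then have "A \<in> sets P" using assms by auto
  then show "(\<lambda>z. ennreal (swap_weight c (hit_count I z A) (hit_count J z A)))
      \<in> borel_measurable (PiM K (\<lambda>_. P))"
    using assms by (intro measurable_compose[OF measurable_swap_weight measurable_ennreal] measurable_hit_count)
qed

text \<open>
  Symmetrization: the law of the double sample is invariant under each swap, so the expectation is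
  an average over swaps.  For fixed points a swap only moves positions inside the trace of \<open>A\<close> on
  these points, so the supremum is bounded by a sum over traces, and each trace contributes at
  most \<open>1\<close> on average.
\<close>
lemma expectation_sup_swap_weight_le:
  assumes P: "prob_space P" and \<A>: "countable \<A>" "\<A> \<subseteq> sets P"
  shows "(\<integral>\<^sup>+z. (SUP A\<in>\<A>. ennreal (swap_weight c (hit_count {1..n} z A) (hit_count {n+1..2*n} z A)))
            \<partial>PiM {1..2*n} (\<lambda>_. P)) \<le> of_nat (shatter_coeff (space P) \<A> (2 * n))"
    (is "integral\<^sup>N ?D ?F \<le> ?S")
proof -
  interpret D: prob_space ?D by (rule prob_space_PiM) (rule P)
  have F[measurable]: "?F \<in> borel_measurable ?D"
    by (rule measurable_sup_swap_weight[OF \<A>]) auto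
  define T where "T J = (\<lambda>z::nat \<Rightarrow> 'a. \<lambda>i\<in>{1..2*n}. z (swap_index n J i))" for J
  have T[measurable]: "T J \<in> measurable ?D ?D" if "J \<in> Pow {1..n}" for J
    unfolding T_def using swap_index_permutes(1)[of J n] that
    by (intro measurable_restrict measurable_component_singleton) auto
  have inv: "integral\<^sup>N ?D ?F = (\<integral>\<^sup>+z. ?F (T J z) \<partial>?D)" if "J \<in> Pow {1..n}" for J
  proof -
    have "distr ?D ?D (T J) = ?D"
      unfolding T_def using swap_index_permutes[of J n] that P by (intro distr_PiM_reindex) auto
    then have "integral\<^sup>N ?D ?F = integral\<^sup>N (distr ?D ?D (T J)) ?F" by simp
    also have "\<dots> = (\<integral>\<^sup>+z. ?F (T J z) \<partial>?D)"
      by (rule nn_integral_distr[OF T[OF that]]) (use F in \<open>simp only: measurable_distr_eq1\<close>)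
    finally show ?thesis .
  qed
  have "2 ^ n * integral\<^sup>N ?D ?F = (\<Sum>J\<in>Pow {1..n}. integral\<^sup>N ?D ?F)"
    by (simp add: card_Pow)
  also have "\<dots> = (\<Sum>J\<in>Pow {1..n}. \<integral>\<^sup>+z. ?F (T J z) \<partial>?D)"
    by (intro sum.cong refl inv)
  also have "\<dots> = (\<integral>\<^sup>+z. (\<Sum>J\<in>Pow {1..n}. ?F (T J z)) \<partial>?D)"
    by (rule nn_integral_sum[symmetric]) (rule measurable_compose[OF T F])
  also have "\<dots> \<le> (\<integral>\<^sup>+z. 2 ^ n * ?S \<partial>?D)"
  proof (rule nn_integral_mono)
    fix z assume "z \<in> space ?D"
    then have z: "z \<in> {1..2*n} \<rightarrow>\<^sub>E space P" by (simp add: space_PiM)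
    define trace where "trace A = (\<lambda>i\<in>{1..2*n}. indicator A (z i) :: nat)" for A
    define G where "G J f = swap_weight c (\<Sum>i=1..n. real (f (swap_index n J i)))
        (\<Sum>i=n+1..2 * n. real (f (swap_index n J i)))" for J and f :: "nat \<Rightarrow> nat"
    note sh = card_traces_le_shatter_coeff[OF z, of \<A>, folded trace_def]
    have G0: "G J f \<ge> 0" for J f by (simp add: G_def swap_weight_def)
    have G: "swap_weight c (hit_count {1..n} (T J z) A) (hit_count {n+1..2*n} (T J z) A) = G J (trace A)"
      if J: "J \<in> Pow {1..n}" for J A
    proof -
      have "indicator A (T J z i) = real (trace A (swap_index n J i))" if "i \<in> {1..2*n}" for i
        using that swap_index_permutes(1)[of J n] J by (auto simp: T_def trace_def indicator_def Pi_iff)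
      then show ?thesis unfolding G_def hit_count_def by (intro arg_cong2[where f="swap_weight c"] sum.cong) auto
    qed
    have "(\<Sum>J\<in>Pow {1..n}. ?F (T J z)) \<le> (\<Sum>J\<in>Pow {1..n}. \<Sum>f\<in>trace ` \<A>. ennreal (G J f))"
    proof (intro sum_mono SUP_least)
      fix J A assume "J \<in> Pow {1..n}" "A \<in> \<A>"
      then show "ennreal (swap_weight c (hit_count {1..n} (T J z) A) (hit_count {n+1..2*n} (T J z) A))
          \<le> (\<Sum>f\<in>trace ` \<A>. ennreal (G J f))"
        unfolding G[OF \<open>J \<in> _\<close>] using sh(1) by (intro member_le_sum) auto
    qed
    also have "\<dots> = (\<Sum>f\<in>trace ` \<A>. ennreal (\<Sum>J\<in>Pow {1..n}. G J f))"
      by (subst sum.swap) (simp add: sum_ennreal G0)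
    also have "\<dots> \<le> (\<Sum>f\<in>trace ` \<A>. ennreal (2 ^ n))"
      by (intro sum_mono ennreal_leI, unfold G_def, rule sum_swap_weight_le) (auto simp: trace_def indicator_def)
    also have "\<dots> = 2 ^ n * of_nat (card (trace ` \<A>))"
      by (simp add: ennreal_power[symmetric] mult.commute)
    also have "\<dots> \<le> 2 ^ n * ?S" using sh(2) by (intro mult_left_mono) auto
    finally show "(\<Sum>J\<in>Pow {1..n}. ?F (T J z)) \<le> 2 ^ n * ?S" .
  qed
  also have "\<dots> = 2 ^ n * ?S" using D.emeasure_space_1 by simp
  finally show ?thesis
    by (subst (asm) ennreal_mult_le_mult_iff) (auto simp: less_top power_eq_top_ennreal)
qed

section \<open>Integrating out the ghost sample\<close>

lemma expectation_hit_count: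
  assumes P: "prob_space P" and A: "A \<in> sets P" and I: "finite I"
  shows "integrable (PiM I (\<lambda>_. P)) (\<lambda>z. hit_count I z A)"
    "(\<integral>z. hit_count I z A \<partial>PiM I (\<lambda>_. P)) = real (card I) * measure P A"
proof -
  interpret P: prob_space P by fact
  have ind: "integrable (PiM I (\<lambda>_. P)) (\<lambda>z. indicator A (z i) :: real)"
    "(\<integral>z. indicator A (z i) \<partial>PiM I (\<lambda>_. P)) = measure P A" if i: "i \<in> I" for i
  proof -
    have d: "distr (PiM I (\<lambda>_. P)) P (\<lambda>z. z i) = P"
      by (rule distr_PiM_component) (use P i in auto)
    have m: "(\<lambda>z. z i) \<in> measurable (PiM I (\<lambda>_. P)) P" using i by simp
    have "integrable P (indicator A :: _ \<Rightarrow> real)"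
      using A by (auto simp: P.emeasure_eq_measure)
    then have "integrable (distr (PiM I (\<lambda>_. P)) P (\<lambda>z. z i)) (indicator A :: _ \<Rightarrow> real)"
      unfolding d .
    then show "integrable (PiM I (\<lambda>_. P)) (\<lambda>z. indicator A (z i) :: real)"
      by (rule integrable_distr[OF m])
    have "(\<integral>z. indicator A (z i) \<partial>PiM I (\<lambda>_. P))
        = integral\<^sup>L (distr (PiM I (\<lambda>_. P)) P (\<lambda>z. z i)) (indicator A :: _ \<Rightarrow> real)"
      by (rule integral_distr[symmetric, OF m]) (use A in simp)
    then show "(\<integral>z. indicator A (z i) \<partial>PiM I (\<lambda>_. P)) = measure P A"
      unfolding d using A by simp
  qed
  show "integrable (PiM I (\<lambda>_. P)) (\<lambda>z. hit_count I z A)"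
    unfolding hit_count_def using ind by (intro Bochner_Integration.integrable_sum) auto
  show "(\<integral>z. hit_count I z A \<partial>PiM I (\<lambda>_. P)) = real (card I) * measure P A"
    unfolding hit_count_def using ind by (subst Bochner_Integration.integral_sum) auto
qed

lemma hit_count_cong: "(\<And>i. i \<in> I \<Longrightarrow> z i = z' i) \<Longrightarrow> hit_count I z A = hit_count I z' A"
  by (simp add: hit_count_def)

lemma hit_count_nonneg: "0 \<le> hit_count I z A"
  by (simp add: hit_count_def sum_nonneg)

text \<open>
  Jensen's inequality in the ghost sample followed by Markov's inequality in the sample.  At each
  point \<open>x\<close> of \<open>E\<close> one set \<open>A\<close> whose weight lies above a line of height \<open>L\<close> at the mean hit count
  forces the conditional expectation of the supremum to be at least \<open>L\<close>.
\<close>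
lemma measure_le_of_supporting_line:
  assumes P: "prob_space P" and \<A>: "countable \<A>" "\<A> \<subseteq> sets P"
    and E: "E \<in> sets (PiM {1..n} (\<lambda>_. P))" and L: "0 \<le> L"
    and line: "\<And>x. x \<in> E \<Longrightarrow> \<exists>A\<in>\<A>. \<exists>\<kappa>. \<forall>y\<ge>0.
        L * (1 + \<kappa> * (y - real n * measure P A)) \<le> swap_weight c (hit_count {1..n} x A) y"
  shows "L * measure (PiM {1..n} (\<lambda>_. P)) E \<le> real (shatter_coeff (space P) \<A> (2 * n))"
proof -
  interpret P: prob_space P by fact
  interpret product_sigma_finite "\<lambda>_ :: nat. P" by unfold_locales
  let ?I = "{1..n}" and ?J = "{n+1..2*n}"
  let ?Q = "PiM ?I (\<lambda>_. P)" and ?G = "PiM ?J (\<lambda>_. P)"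
  interpret Q: prob_space ?Q by (rule prob_space_PiM) (rule P)
  interpret G: prob_space ?G by (rule prob_space_PiM) (rule P)
  define W where "W z = (SUP A\<in>\<A>. ennreal (swap_weight c (hit_count ?I z A) (hit_count ?J z A)))"
    for z :: "nat \<Rightarrow> 'a"
  have IJ: "{1..2*n} = ?I \<union> ?J" "?I \<inter> ?J = {}" by auto
  have W: "W \<in> borel_measurable (PiM (?I \<union> ?J) (\<lambda>_. P))"
    unfolding W_def
    by (rule measurable_sup_swap_weight[OF \<A>]) auto
  have ghost: "ennreal L \<le> (\<integral>\<^sup>+y. W (merge ?I ?J (x, y)) \<partial>?G)" if x: "x \<in> E" for x
  proof -
    obtain A \<kappa> where A: "A \<in> \<A>" and \<kappa>: "\<And>y. 0 \<le> y \<Longrightarrow>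
        L * (1 + \<kappa> * (y - real n * measure P A)) \<le> swap_weight c (hit_count ?I x A) y"
      using line[OF x] by blast
    define l where "l y = L * (1 + \<kappa> * (hit_count ?J y A - real n * measure P A))" for y
    have AP: "A \<in> sets P" using A \<A> by auto
    note ex = expectation_hit_count[OF P AP, of ?J]
    \<comment> \<open>The slope term vanishes on average, whatever \<open>\<kappa>\<close> is.\<close>
    have l: "l = (\<lambda>y. L * (1 - \<kappa> * (real n * measure P A)) + L * \<kappa> * hit_count ?J y A)"
      by (simp add: l_def fun_eq_iff algebra_simps)
    have int_l: "integrable ?G l" unfolding l
      by (intro Bochner_Integration.integrable_add integrable_mult_right ex(1) G.integrable_const) simp
    have "(\<integral>y. l y \<partial>?G) = (\<integral>y. L * (1 - \<kappa> * (real n * measure P A)) \<partial>?G) + (\<integral>y. L * \<kappa> * hit_count ?J y A \<partial>?G)"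
      unfolding l by (intro Bochner_Integration.integral_add integrable_mult_right ex(1) G.integrable_const) simp
    also have "\<dots> = L * (1 - \<kappa> * (real n * measure P A)) + L * \<kappa> * (real (card ?J) * measure P A)"
      using G.prob_space ex(2) by simp
    also have "\<dots> = L" by (simp add: algebra_simps)
    finally have "ennreal L = ennreal (\<integral>y. l y \<partial>?G)" by simp
    \<comment> \<open>The line may be negative, whereas the weight is positive and so dominates its positive part.\<close>
    also have "\<dots> \<le> ennreal (\<integral>y. max 0 (l y) \<partial>?G)"
      using int_l by (intro ennreal_leI integral_mono) auto
    also have "\<dots> = (\<integral>\<^sup>+y. max 0 (l y) \<partial>?G)"
      using int_l by (intro nn_integral_eq_integral[symmetric]) auto
    also have "\<dots> \<le> (\<integral>\<^sup>+y. W (merge ?I ?J (x, y)) \<partial>?G)"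
    proof (rule nn_integral_mono)
      fix y
      have "ennreal (max 0 (l y)) \<le> ennreal (swap_weight c (hit_count ?I x A) (hit_count ?J y A))"
        unfolding l_def using \<kappa>[OF hit_count_nonneg]
        by (intro ennreal_leI) (auto simp: swap_weight_def)
      also have "hit_count ?I x A = hit_count ?I (merge ?I ?J (x, y)) A"
        by (rule hit_count_cong) auto
      also have "hit_count ?J y A = hit_count ?J (merge ?I ?J (x, y)) A"
        by (rule hit_count_cong) auto
      finally show "ennreal (max 0 (l y)) \<le> W (merge ?I ?J (x, y))"
        unfolding W_def using A by (meson SUP_upper order_trans)
    qed
    finally show ?thesis .
  qed
  have "ennreal (L * measure ?Q E) = (\<integral>\<^sup>+x. ennreal L * indicator E x \<partial>?Q)"
    using E L Q.emeasure_eq_measure[of E] by (simp add: nn_integral_cmult_indicator ennreal_mult)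
  also have "\<dots> \<le> (\<integral>\<^sup>+x. (\<integral>\<^sup>+y. W (merge ?I ?J (x, y)) \<partial>?G) \<partial>?Q)"
    by (intro nn_integral_mono) (use ghost in \<open>auto simp: indicator_def\<close>)
  also have "\<dots> = integral\<^sup>N (PiM {1..2*n} (\<lambda>_. P)) W"
    unfolding IJ(1) by (rule product_nn_integral_fold[symmetric]) (use IJ W in auto)
  also have "\<dots> \<le> of_nat (shatter_coeff (space P) \<A> (2 * n))"
    unfolding W_def by (rule expectation_sup_swap_weight_le[OF P \<A>])
  finally show ?thesis by (simp add: ennreal_of_nat_eq_real_of_nat)
qed

section \<open>Large relative deviations\<close>

text \<open>
  For a large deviation \<open>c * scaled_diff a x \<ge> c\<^sup>2\<close>, so the weight at the mean is at least
  \<open>exp (c\<^sup>2 - c\<^sup>2 / 2)\<close>; hence the choice \<open>L = exp (c\<^sup>2 / 2)\<close> of the height.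
\<close>
lemma swap_weight_ge_line:
  assumes k: "1 + \<kappa> * (y - x) \<le> exp (c * (scaled_diff a y - scaled_diff a x))"
    and gap: "c\<^sup>2 \<le> c * scaled_diff a x"
  shows "exp (c\<^sup>2 / 2) * (1 + \<kappa> * (y - x)) \<le> swap_weight c a y"
proof -
  have "exp (c\<^sup>2 / 2) * (1 + \<kappa> * (y - x)) \<le> exp (c\<^sup>2 / 2) * exp (c * (scaled_diff a y - scaled_diff a x))"
    using k by (intro mult_left_mono) auto
  also have "\<dots> = exp (c\<^sup>2 / 2 + c * scaled_diff a y - c * scaled_diff a x)"
    by (simp add: exp_add[symmetric] right_diff_distrib)
  also have "\<dots> \<le> swap_weight c a y"
    unfolding swap_weight_def using gap by simp
  finally show ?thesis .
qed

text \<open>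
  Normalizing by \<open>sqrt (a + b)\<close> instead of \<open>sqrt a\<close> loses at most a factor \<open>sqrt 2\<close>, since \<open>b \<le> a\<close>.
  This loss turns the exponent \<open>n t\<^sup>2 / 2\<close> into \<open>n t\<^sup>2 / 4\<close>.
\<close>
lemma scaled_diff_ge:
  assumes c: "0 \<le> c" and ab: "0 \<le> b" "b \<le> a" and gap: "a - b > sqrt 2 * c * sqrt a"
  shows "c \<le> scaled_diff a b"
proof -
  have a: "a > 0"
  proof (rule ccontr)
    assume "\<not> a > 0"
    then have "a = 0" "b = 0" using ab by auto
    then show False using gap by simp
  qed
  then have s: "sqrt (a + b) > 0" using ab by simp
  have "c * sqrt (a + b) \<le> c * (sqrt 2 * sqrt a)"
    using c ab by (intro mult_left_mono) (simp_all flip: real_sqrt_mult)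
  also have "\<dots> \<le> a - b" using gap by (simp add: mult_ac)
  finally show ?thesis unfolding scaled_diff_def using s by (simp add: le_divide_eq)
qed

lemma scaled_diff_swap: "scaled_diff b a = - scaled_diff a b"
  unfolding scaled_diff_def minus_divide_left minus_diff_eq by (simp only: add.commute)

text \<open>Events that depend on the random variables alone can be measured under the product law.\<close>
lemma measure_iid_sample:
  fixes M :: "'w measure" and P :: "'a measure" and Z :: "nat \<Rightarrow> 'w \<Rightarrow> 'a"
  assumes "prob_space M" and "n \<ge> 1"
    and indep: "prob_space.indep_vars M (\<lambda>_. P) Z {1..n}"
    and distr: "\<And>i. i \<in> {1..n} \<Longrightarrow> distr M P (Z i) = P"
    and Q: "{x\<in>space (PiM {1..n} (\<lambda>_. P)). Q x} \<in> sets (PiM {1..n} (\<lambda>_. P))"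
    and eq: "\<And>\<omega>. \<omega> \<in> space M \<Longrightarrow> R \<omega> \<longleftrightarrow> Q (\<lambda>i\<in>{1..n}. Z i \<omega>)"
  shows "measure M {\<omega>\<in>space M. R \<omega>}
    = measure (PiM {1..n} (\<lambda>_. P)) {x\<in>space (PiM {1..n} (\<lambda>_. P)). Q x}"
proof -
  interpret M: prob_space M by fact
  let ?Q = "PiM {1..n} (\<lambda>_. P)" and ?X = "\<lambda>\<omega>. \<lambda>i\<in>{1..n}. Z i \<omega>"
  have rv: "Z i \<in> measurable M P" if "i \<in> {1..n}" for i
    using indep that unfolding M.indep_vars_def by auto
  have X: "?X \<in> measurable M ?Q" using rv by (intro measurable_restrict) auto
  have "distr M ?Q ?X = PiM {1..n} (\<lambda>i. distr M P (Z i))"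
    using M.indep_vars_iff_distr_eq_PiM'[where I = "{1..n}" and M' = "\<lambda>_. P" and X = Z] rv indep \<open>n \<ge> 1\<close> by simp
  also have "\<dots> = ?Q" using distr by (intro PiM_cong) auto
  finally have "measure ?Q {x\<in>space ?Q. Q x} = measure (distr M ?Q ?X) {x\<in>space ?Q. Q x}" by simp
  also have "\<dots> = measure M (?X -` {x\<in>space ?Q. Q x} \<inter> space M)"
    by (rule measure_distr[OF X Q])
  also have "?X -` {x\<in>space ?Q. Q x} \<inter> space M = {\<omega>\<in>space M. R \<omega>}"
    using measurable_space[OF X] eq by auto
  finally show ?thesis by simp
qed

text \<open>
  A vanishing denominator comes with a nonpositive numerator, so the quotient is \<open>0\<close> or
  \<open>-\<infinity>\<close> and does not exceed \<open>t\<close>; clearing denominators is therefore harmless.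
\<close>
lemma ereal_ratio_gt_iff:
  fixes a b d t :: real
  assumes t: "t > 0" and a: "a \<ge> 0" and d: "a = 0 \<Longrightarrow> d \<le> 0"
  shows "ereal t < ereal d / ereal (sqrt a) \<longleftrightarrow> t * sqrt a < d"
proof (cases "a = 0")
  case True
  then have "ereal d / ereal (sqrt a) \<le> 0"
    using d by (cases "d = 0") (auto simp: divide_ereal_def)
  then have "\<not> ereal t < ereal d / ereal (sqrt a)"
    using t by (metis ereal_less(2) less_le_trans not_less order_less_imp_le zero_ereal_def)
  then show ?thesis using True d by auto
next
  case False
  then have "sqrt a > 0" using a by simp
  then show ?thesis by (simp add: less_divide_eq)
qed

lemma empirical_measure_eq_hit_count:
  "real n * empirical_measure n Z \<omega> A = hit_count {1..n} (\<lambda>i\<in>{1..n}. Z i \<omega>) A" if "n \<ge> 1"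
  using that by (simp add: empirical_measure_def hit_count_def)

lemma shatter_coeff_pos:
  assumes "S \<noteq> {}" "\<A> \<noteq> {}"
  shows "shatter_coeff S \<A> m \<ge> 1"
proof -
  obtain s where "s \<in> S" using assms by auto
  then have "(\<lambda>i\<in>{1..m}. s) \<in> {1..m} \<rightarrow>\<^sub>E S" by auto
  from card_traces_le_shatter_coeff[OF this, of \<A>] show ?thesis
    using assms(2) by (metis (no_types, lifting) card_gt_0_iff image_is_empty less_le_trans less_one not_le)
qed

lemma one_le_three_exp: "3 * exp (- x) \<ge> 1" if "x \<le> 17 / 16" for x :: real
proof -
  have "exp (1 / 16 :: real) \<le> 16 / 15"
    using exp_ge_add_one_self[of "- 1 / 16 :: real"] by (simp add: exp_minus field_simps)
  then have "exp 1 * exp (1 / 16 :: real) \<le> 272 / 100 * (16 / 15)"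
    using e_less_272 by (intro mult_mono) auto
  then have "exp (17 / 16 :: real) \<le> 3" by (simp flip: exp_add)
  then have "exp x \<le> 3" using that by (meson exp_le_cancel_iff order_trans)
  then show ?thesis by (simp add: exp_minus field_simps)
qed

theorem theorem1:
  fixes M :: "'w measure" and P :: "'a measure"
    and Z :: "nat \<Rightarrow> 'w \<Rightarrow> 'a" and \<A> :: "'a set set"
    and n :: nat and t :: real
  assumes "prob_space M" and "prob_space P"
    and "n \<ge> 1"
    and "prob_space.indep_vars M (\<lambda>_. P) Z {1..n}"
    and "\<And>i. i \<in> {1..n} \<Longrightarrow> distr M P (Z i) = P"
    and "countable \<A>" and "\<A> \<subseteq> sets P"
    and "t > 0"
  shows "\<P>(\<omega> in M. sup_dev_empirical P n Z \<A> \<omega> > ereal t)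
           \<le> real (shatter_coeff (space P) \<A> (2 * n)) * exp (- (real n * t\<^sup>2 / 4))
       \<and> \<P>(\<omega> in M. sup_dev_true P n Z \<A> \<omega> > ereal t)
           \<le> 3 * real (shatter_coeff (space P) \<A> (2 * n)) * exp (- (real n * t\<^sup>2 / 4))"
proof -
  interpret P: prob_space P by fact
  let ?Q = "PiM {1..n} (\<lambda>_. P)" and ?S = "real (shatter_coeff (space P) \<A> (2 * n))"
  let ?X = "\<lambda>\<omega>. \<lambda>i\<in>{1..n}. Z i \<omega>" and ?N = "\<lambda>x A. hit_count {1..n} x A"
  define p where "p A = real n * measure P A" for A
  \<comment> \<open>This \<open>c\<close> makes \<open>c\<^sup>2 / 2\<close> the exponent and \<open>sqrt 2 * c = t * sqrt n\<close> the threshold for hit counts.\<close>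
  define c where "c = t * sqrt n / sqrt 2"
  have n: "real n > 0" using assms(3) by simp
  have c0: "c \<ge> 0" and c2: "c\<^sup>2 / 2 = real n * t\<^sup>2 / 4"
    using assms(8) by (auto simp: c_def power_mult_distrib power_divide)
  have p0: "p A \<ge> 0" for A by (simp add: p_def)
  have rescale: "t * sqrt b < d \<longleftrightarrow> sqrt 2 * c * sqrt (real n * b) < real n * d" for b d
  proof -
    have "sqrt 2 * c * sqrt (real n * b) = real n * (t * sqrt b)"
      using n by (simp add: c_def real_sqrt_mult)
    then show ?thesis using n by simp
  qed
  define E1 where "E1 x \<longleftrightarrow> (\<exists>A\<in>\<A>. sqrt 2 * c * sqrt (?N x A) < ?N x A - p A)" for x
  define E2 where "E2 x \<longleftrightarrow> (\<exists>A\<in>\<A>. sqrt 2 * c * sqrt (p A) < p A - ?N x A)" for x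
  have mN: "(\<lambda>x. ?N x A) \<in> borel_measurable ?Q" if "A \<in> \<A>" for A
    using that assms(7) by (intro measurable_hit_count) auto
  have E1: "{x\<in>space ?Q. E1 x} \<in> sets ?Q" and E2: "{x\<in>space ?Q. E2 x} \<in> sets ?Q"
  proof -
    have "{x\<in>space ?Q. sqrt 2 * c * sqrt (?N x A) < ?N x A - p A} \<in> sets ?Q"
      "{x\<in>space ?Q. sqrt 2 * c * sqrt (p A) < p A - ?N x A} \<in> sets ?Q" if "A \<in> \<A>" for A
      using mN[OF that] by measurable
    then show "{x\<in>space ?Q. E1 x} \<in> sets ?Q" "{x\<in>space ?Q. E2 x} \<in> sets ?Q"
      unfolding E1_def E2_def using assms(6) by (auto intro!: sets.sets_Collect_countable_Ex')
  qed
  have emp0: "empirical_measure n Z \<omega> A \<ge> 0" for \<omega> A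
    by (simp add: empirical_measure_def sum_nonneg)
  note emp = empirical_measure_eq_hit_count[OF assms(3)]
  have R1: "ereal t < sup_dev_empirical P n Z \<A> \<omega> \<longleftrightarrow> E1 (?X \<omega>)" for \<omega>
    unfolding sup_dev_empirical_def less_SUP_iff E1_def
    by (subst ereal_ratio_gt_iff)
       (use emp0 assms(8) in \<open>auto simp: rescale right_diff_distrib emp p_def\<close>)
  have R2: "ereal t < sup_dev_true P n Z \<A> \<omega> \<longleftrightarrow> E2 (?X \<omega>)" for \<omega>
    unfolding sup_dev_true_def less_SUP_iff E2_def
    by (subst ereal_ratio_gt_iff)
       (use emp0 assms(8) in \<open>auto simp: rescale right_diff_distrib emp p_def\<close>)
  have P1: "\<P>(\<omega> in M. ereal t < sup_dev_empirical P n Z \<A> \<omega>) = measure ?Q {x\<in>space ?Q. E1 x}"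
    by (rule measure_iid_sample[OF assms(1,3,4,5) E1 R1])
  have P2: "\<P>(\<omega> in M. ereal t < sup_dev_true P n Z \<A> \<omega>) = measure ?Q {x\<in>space ?Q. E2 x}"
    by (rule measure_iid_sample[OF assms(1,3,4,5) E2 R2])
  have "exp (c\<^sup>2 / 2) * measure ?Q {x\<in>space ?Q. E1 x} \<le> ?S"
  proof (rule measure_le_of_supporting_line[OF assms(2,6,7) E1, where c = c])
    fix x assume "x \<in> {x\<in>space ?Q. E1 x}"
    then obtain A where A: "A \<in> \<A>" and gap: "sqrt 2 * c * sqrt (?N x A) < ?N x A - p A"
      by (auto simp: E1_def)
    have "0 \<le> sqrt 2 * c * sqrt (?N x A)" using c0 hit_count_nonneg[of _ x A] by auto
    then have less: "p A < ?N x A" using gap by linarith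
    have "c \<le> scaled_diff (?N x A) (p A)" using gap less c0 p0 by (intro scaled_diff_ge) auto
    then have "c\<^sup>2 \<le> c * scaled_diff (?N x A) (p A)"
      using c0 by (simp add: power2_eq_square mult_left_mono)
    moreover have "\<exists>\<kappa>. \<forall>y\<ge>0. 1 + \<kappa> * (y - p A) \<le> exp (c * (scaled_diff (?N x A) y - scaled_diff (?N x A) (p A)))"
      using less p0[of A] c0 by (intro supporting_line_excess) auto
    ultimately show "\<exists>A\<in>\<A>. \<exists>\<kappa>. \<forall>y\<ge>0. exp (c\<^sup>2 / 2) * (1 + \<kappa> * (y - real n * measure P A))
        \<le> swap_weight c (?N x A) y"
      using A swap_weight_ge_line unfolding p_def by metis
  qed simp
  then have B1: "measure ?Q {x\<in>space ?Q. E1 x} \<le> ?S * exp (- (real n * t\<^sup>2 / 4))"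
    unfolding c2 by (simp add: exp_minus field_simps)
  have B2: "measure ?Q {x\<in>space ?Q. E2 x} \<le> 3 * ?S * exp (- (real n * t\<^sup>2 / 4))"
  proof (cases "real n * t\<^sup>2 / 4 \<le> 17 / 16")
    case True
    \<comment> \<open>For small \<open>n t\<^sup>2\<close> the factor \<open>3\<close> makes the bound at least \<open>1\<close>.\<close>
    interpret Q: prob_space ?Q by (rule prob_space_PiM) (rule assms(2))
    show ?thesis
    proof (cases "\<A> = {}")
      case False
      have "1 * 1 \<le> ?S * (3 * exp (- (real n * t\<^sup>2 / 4)))"
        using shatter_coeff_pos[OF P.not_empty False] one_le_three_exp[OF True]
        by (intro mult_mono) auto
      then show ?thesis using Q.prob_le_1[of "{x\<in>space ?Q. E2 x}"] by linarith
    qed (simp add: E2_def)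
  next
    case False
    have "exp ((- c)\<^sup>2 / 2) * measure ?Q {x\<in>space ?Q. E2 x} \<le> ?S"
    proof (rule measure_le_of_supporting_line[OF assms(2,6,7) E2, where c = "- c"])
      fix x assume "x \<in> {x\<in>space ?Q. E2 x}"
      then obtain A where A: "A \<in> \<A>" and gap: "sqrt 2 * c * sqrt (p A) < p A - ?N x A"
        by (auto simp: E2_def)
      have N0: "0 \<le> ?N x A" by (rule hit_count_nonneg)
      have "0 \<le> sqrt 2 * c * sqrt (p A)" using c0 p0[of A] by auto
      then have less: "?N x A < p A" using gap by linarith
      have "c \<le> scaled_diff (p A) (?N x A)" using gap less c0 N0 by (intro scaled_diff_ge) auto
      then have "(- c)\<^sup>2 \<le> - c * scaled_diff (?N x A) (p A)"
        using c0 unfolding scaled_diff_swap[of "?N x A" "p A"] by (simp add: power2_eq_square mult_left_mono)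
      \<comment> \<open>The event forces \<open>sqrt (p A) > sqrt 2 * c\<close>, so \<open>c * sqrt (p A) > sqrt 2 * c\<^sup>2\<close>, which is at least
        \<open>3\<close> because \<open>c\<^sup>2 > 17 / 8 > 3 / sqrt 2\<close>.\<close>
      moreover have "3 \<le> c * sqrt (?N x A + p A)"
      proof -
        have "sqrt 2 * c * sqrt (p A) < sqrt (p A) * sqrt (p A)" using gap N0 p0[of A] by simp
        then have "sqrt 2 * c < sqrt (p A)"
          using p0[of A] by (metis mult_right_less_imp_less real_sqrt_ge_zero)
        also have "\<dots> \<le> sqrt (?N x A + p A)" using N0 by simp
        finally have "c * (sqrt 2 * c) \<le> c * sqrt (?N x A + p A)"
          using c0 by (intro mult_left_mono) auto
        moreover have "3 \<le> sqrt 2 * c\<^sup>2"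
        proof (rule power2_le_imp_le)
          have "17 / 8 \<le> c\<^sup>2" using False c2 by linarith
          then have "(17 / 8)\<^sup>2 \<le> (c\<^sup>2)\<^sup>2" by (intro power_mono) auto
          then have "3\<^sup>2 \<le> 2 * (c\<^sup>2)\<^sup>2" by (simp add: power2_eq_square)
          then show "3\<^sup>2 \<le> (sqrt 2 * c\<^sup>2)\<^sup>2" unfolding power_mult_distrib by simp
        qed simp
        ultimately show ?thesis by (simp add: power2_eq_square mult_ac)
      qed
      then have "\<exists>\<kappa>. \<forall>y\<ge>0. 1 + \<kappa> * (y - p A)
          \<le> exp (- c * (scaled_diff (?N x A) y - scaled_diff (?N x A) (p A)))"
        using N0 p0[of A] by (intro supporting_line_deficit) auto
      ultimately show "\<exists>A\<in>\<A>. \<exists>\<kappa>. \<forall>y\<ge>0. exp ((- c)\<^sup>2 / 2) * (1 + \<kappa> * (y - real n * measure P A))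
          \<le> swap_weight (- c) (?N x A) y"
        using A swap_weight_ge_line[where c = "- c"] unfolding p_def by metis
    qed simp
    then have "measure ?Q {x\<in>space ?Q. E2 x} \<le> ?S * exp (- (real n * t\<^sup>2 / 4))"
      unfolding power2_minus c2 by (simp add: exp_minus field_simps)
    also have "\<dots> \<le> 3 * ?S * exp (- (real n * t\<^sup>2 / 4))" by simp
    finally show ?thesis .
  qed
  show ?thesis unfolding P1 P2 using B1 B2 by blast
qed

end
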